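(* Let $d\ge 2$ and $\left\lfloor\frac{d+1}{2}\right\rfloor\le k\le d-1$. Then $N(d,k)<\binom{d+1}{d-k}(d-k)(k+1)(d+1)/2$. (In this range $G(d,k)=1$, so every $n\ge\binom{d+1}{d-k}(d-k)(k+1)(d+1)/2$ is the number of $k$-dimensional faces of some simple $d$-polytope.)
   Context: Binomial coefficients satisfy $\binom{a}{b}=0$ when $0\le a<b$. Let $\delta=\lfloor d/2\rfloor$, $m_{i,k}=\binom{d+1-i}{k+1}-\binom{i}{k+1}$ for $0\le i\le\delta$, and $G(d,k)=\gcd(m_{1,k},\dots,m_{\delta,k})$. A $d$-polytope is simple if every vertex lies in exactly $d$ facets. $N(d,k)$ denotes the least integer $N$ such that for every integer $n>N$: $n$ is the number of $k$-dimensional faces of some simple $d$-polytope if and only if $n\equiv 0\pmod{G(d,k)}$. *)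

theory Defs
  imports "HOL-Analysis.Analysis" "HOL-Number_Theory.Cong"
begin

definition m_coeff :: "nat \<Rightarrow> nat \<Rightarrow> nat \<Rightarrow> int" where
  "m_coeff d i k = int ((d + 1 - i) choose (k + 1)) - int (i choose (k + 1))"

definition G_gcd :: "nat \<Rightarrow> nat \<Rightarrow> int" where
  "G_gcd d k = Gcd ((\<lambda>i. m_coeff d i k) ` {1..d div 2})"

definition d_polytope :: "nat \<Rightarrow> 'a::euclidean_space set \<Rightarrow> bool" where
  "d_polytope d P \<longleftrightarrow> polytope P \<and> aff_dim P = int d"

definition simple_d_polytope :: "nat \<Rightarrow> 'a::euclidean_space set \<Rightarrow> bool" where
  "simple_d_polytope d P \<longleftrightarrow>
     d_polytope d P \<and> (\<forall>v. v extreme_point_of P \<longrightarrow> card {F. F facet_of P \<and> v \<in> F} = d)"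

definition num_faces :: "nat \<Rightarrow> 'a::euclidean_space set \<Rightarrow> nat" where
  "num_faces k P = card {F. F face_of P \<and> aff_dim F = int k}"

text \<open>
  The type argument only names the ambient Euclidean space of the polytopes; the notion is
  meant for ambient dimension at least \<open>d\<close>, and then does not depend on the choice, since
  a polytope of dimension \<open>d\<close> can be moved into any such space by an affine isomorphism
  of its affine hull.
\<close>

definition is_simple_face_number :: "'a::euclidean_space itself \<Rightarrow> nat \<Rightarrow> nat \<Rightarrow> int \<Rightarrow> bool" where
  "is_simple_face_number _ d k n \<longleftrightarrow>
     (\<exists>P::'a set. simple_d_polytope d P \<and> n = int (num_faces k P))"

definition N_threshold :: "'a::euclidean_space itself \<Rightarrow> nat \<Rightarrow> nat \<Rightarrow> int" where
  "N_threshold T d k =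
     (LEAST N. \<forall>n>N. is_simple_face_number T d k n \<longleftrightarrow> [n = 0] (mod G_gcd d k))"

end

theory Submission imports Defs begin

text \<open>
  Put \<open>r = d - k\<close>, so that \<open>r \<le> k\<close>. A simple polytope is described by inequalities whose normals are
  linearly independent wherever they are simultaneously tight. The sets of inequalities tight at some
  point form a simplicial complex whose \<open>r\<close>-element members correspond to the \<open>k\<close>-faces, and
  truncating a face is a stellar subdivision of this complex. Truncating an \<open>(i - 1)\<close>-face that is a
  simplex, with \<open>1 \<le> i \<le> r\<close>, adds exactly \<open>M - D\<^sub>i\<close> faces of dimension \<open>k\<close>, where
  \<open>M = (d + 1) choose (k + 2)\<close> and \<open>D\<^sub>i = (d + 1 - i) choose (k + 2)\<close>, and starting from the
  simplex such truncations can be repeated in any order. As \<open>D\<^sub>r = 0\<close>, \<open>D\<^sub>r\<^sub>-\<^sub>1 = 1\<close> and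
  consecutive \<open>D\<^sub>i\<close> have ratio at most \<open>k + 3\<close>, every integer in \<open>{0..<M}\<close> is a sum of at most
  \<open>(r - 1) (k + 2)\<close> of the \<open>D\<^sub>i\<close>. With \<open>C = (d + 1) choose r\<close> and \<open>(k + 2) M = r C\<close>, all
  \<open>n \<ge> C (1 + r (r - 1))\<close> are therefore numbers of \<open>k\<close>-faces.
\<close>

section \<open>Inequality systems in general position and the face structure of their cells\<close>

definition cell :: "'a::euclidean_space set \<Rightarrow> (nat \<Rightarrow> 'a) \<Rightarrow> (nat \<Rightarrow> real) \<Rightarrow> nat set \<Rightarrow> 'a set" where
  "cell L a b I = {x \<in> L. \<forall>i\<in>I. a i \<bullet> x \<le> b i}"

definition tight :: "(nat \<Rightarrow> 'a::euclidean_space) \<Rightarrow> (nat \<Rightarrow> real) \<Rightarrow> nat set \<Rightarrow> 'a \<Rightarrow> nat set" where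
  "tight a b I x = {i \<in> I. a i \<bullet> x = b i}"

text \<open>Encoded so that neither the boundary of \<sigma> nor its link has to be formed: for a
  simplicial complex, the \<tau> coned with \<open>v\<close> are exactly the members of the join of
  the two.\<close>

definition stellar :: "'v set \<Rightarrow> 'v \<Rightarrow> 'v set set \<Rightarrow> 'v set set" where
  "stellar \<sigma> v \<Delta> = {\<tau> \<in> \<Delta>. \<not> \<sigma> \<subseteq> \<tau>} \<union> insert v ` {\<tau> \<in> \<Delta>. \<not> \<sigma> \<subseteq> \<tau> \<and> \<tau> \<union> \<sigma> \<in> \<Delta>}"

text \<open>A linear functional with the wanted values on \<open>B\<close> is the inner product with
  some \<open>w\<close>, and projecting \<open>w\<close> orthogonally to \<open>span B\<close> keeps
  these values. Staying in the span later keeps directions inside \<open>L\<close>.\<close>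

lemma independent_inner_values_exist:
  fixes B :: "'a::euclidean_space set"
  assumes "independent B"
  shows "\<exists>u\<in>span B. \<forall>x\<in>B. x \<bullet> u = f x"
proof -
  obtain h :: "'a \<Rightarrow> real" where h: "linear h" "\<forall>x\<in>B. h x = f x"
    using linear_independent_extend[OF assms] by blast
  define w where "w = adjoint h 1"
  have w: "x \<bullet> w = h x" for x
    using adjoint_works[OF h(1), of x 1] by (simp add: w_def)
  obtain y z where yz: "y \<in> span B" "\<And>v. v \<in> span B \<Longrightarrow> orthogonal z v" "w = y + z"
    using orthogonal_subspace_decomp_exists[of B w] by metis
  have "x \<bullet> y = f x" if "x \<in> B" for x
    using w[of x] h(2) yz(2)[OF span_base[OF that]] that yz(3)
    by (auto simp: inner_add_right orthogonal_def inner_commute)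
  then show ?thesis using yz(1) by blast
qed

text \<open>The cell lives in a subspace \<open>L\<close>, so that the ambient space may have larger
  dimension; normals in \<open>L\<close> make codimensions count within \<open>L\<close>.
  Injectivity is a separate axiom because independence of the image set does not see repeated
  normals.\<close>

locale simple_system =
  fixes L :: "'a::euclidean_space set" and a :: "nat \<Rightarrow> 'a" and b :: "nat \<Rightarrow> real" and I :: "nat set"
  assumes subspace_L: "subspace L"
    and finite_I: "finite I"
    and normals_in_L: "i \<in> I \<Longrightarrow> a i \<in> L"
    and bounded_cell: "bounded (cell L a b I)"
    and cell_nonempty: "cell L a b I \<noteq> {}"
    and inj_normals: "x \<in> cell L a b I \<Longrightarrow> inj_on a (tight a b I x)"
    and independent_normals: "x \<in> cell L a b I \<Longrightarrow> independent (a ` tight a b I x)"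
begin

abbreviation "P \<equiv> cell L a b I"
abbreviation "T \<equiv> tight a b I"

text \<open>The boundary complex of the dual simplicial polytope. An inequality that is tight
  nowhere leaves no trace in it.\<close>

definition "complex = T ` P"

definition "face \<tau> = {x \<in> P. \<tau> \<subseteq> T x}"

lemma tight_subset: "T x \<subseteq> I"
  by (auto simp: tight_def)

lemma finite_complex: "finite complex"
proof (rule finite_subset)
  show "complex \<subseteq> Pow I" using tight_subset by (auto simp: complex_def)
qed (use finite_I in simp)

lemma complex_subset: "\<tau> \<in> complex \<Longrightarrow> \<tau> \<subseteq> I"
  using tight_subset by (auto simp: complex_def)

lemma normal_not_in_span:
  assumes "x \<in> P" "S \<subseteq> T x" "i \<in> T x" "i \<notin> S"
  shows "a i \<notin> span (a ` S)"
proof -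
  have "a ` S \<subseteq> a ` T x - {a i}"
    using assms inj_normals[OF assms(1)] by (auto dest: inj_onD)
  then show ?thesis
    using independent_normals[OF assms(1)] assms(3) span_mono unfolding dependent_def by blast
qed

lemma direction_exists:
  assumes "x \<in> P"
  shows "\<exists>u\<in>L. \<forall>i\<in>T x. a i \<bullet> u = g i"
proof -
  obtain u where u: "u \<in> span (a ` T x)" "\<forall>y\<in>a ` T x. y \<bullet> u = g (the_inv_into (T x) a y)"
    using independent_inner_values_exist[OF independent_normals[OF assms],
        of "\<lambda>y. g (the_inv_into (T x) a y)"] by blast
  have "span (a ` T x) \<subseteq> L"
    using tight_subset normals_in_L by (intro span_minimal subspace_L) auto
  then show ?thesis
    using u the_inv_into_f_f[OF inj_normals[OF assms]] by (intro bexI[of _ u]) auto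
qed

definition "slack x = {y. \<forall>i\<in>I - T x. a i \<bullet> y < b i}"

lemma open_slack: "open (slack x)"
proof -
  have "slack x = (\<Inter>i\<in>I - T x. {y. a i \<bullet> y < b i})" by (auto simp: slack_def)
  then show ?thesis using finite_I by (auto intro!: open_INT open_halfspace_lt)
qed

lemma in_slack: "x \<in> P \<Longrightarrow> x \<in> slack x"
  by (force simp: slack_def cell_def tight_def)

text \<open>Moving a short way from \<open>x\<close> along a direction that preserves the
  inequalities in \<tau> and relaxes the other tight ones ends at a point with tight set \<tau>.
  This makes \<open>complex\<close> closed under subsets.\<close>

lemma tight_subset_realized:
  assumes "x \<in> P" "\<tau> \<subseteq> T x"
  shows "\<exists>y\<in>P. T y = \<tau>"
proof -
  obtain u where u: "u \<in> L" "\<forall>i\<in>T x. a i \<bullet> u = (if i \<in> \<tau> then 0 else -1)"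
    using direction_exists[OF assms(1), of "\<lambda>i. if i \<in> \<tau> then 0 else -1"] by blast
  obtain e where e: "e > 0" "ball x e \<subseteq> slack x"
    using open_slack in_slack[OF assms(1)] open_contains_ball by blast
  \<comment> \<open>The summand 1 avoids division by zero when \<open>u = 0\<close>.\<close>
  define t where "t = e / (norm u + 1)"
  have t: "t > 0" using e by (auto simp: t_def intro!: divide_pos_pos add_nonneg_pos)
  have "t * norm u < e"
    using e(1) norm_ge_zero[of u] by (simp add: t_def divide_less_eq add_nonneg_pos distrib_left)
  then have "x + t *\<^sub>R u \<in> slack x"
    using e(2) t by (auto simp: dist_norm)
  then have sl: "a i \<bullet> (x + t *\<^sub>R u) < b i" if "i \<in> I" "i \<notin> T x" for i
    using that by (auto simp: slack_def)
  have on: "a i \<bullet> (x + t *\<^sub>R u) = (if i \<in> \<tau> then b i else b i - t)" if "i \<in> T x" for i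
    using that u(2) by (auto simp: inner_add_right tight_def)
  have "x + t *\<^sub>R u \<in> L"
    using assms(1) u(1) subspace_L by (auto simp: cell_def subspace_add subspace_scale)
  moreover have "a i \<bullet> (x + t *\<^sub>R u) \<le> b i" if "i \<in> I" for i
    using sl[OF that] on[of i] t by (cases "i \<in> T x") (auto split: if_splits)
  moreover have "i \<in> T (x + t *\<^sub>R u) \<longleftrightarrow> i \<in> \<tau>" for i
  proof (cases "i \<in> T x")
    case True
    then show ?thesis using on[OF True] t tight_subset[of x] by (auto simp: tight_def)
  next
    case False
    then show ?thesis using sl[of i] assms(2) by (auto simp: tight_def)
  qed
  ultimately show ?thesis by (intro bexI[of _ "x + t *\<^sub>R u"]) (auto simp: cell_def)
qed

lemma complex_down: "\<tau> \<in> complex \<Longrightarrow> \<rho> \<subseteq> \<tau> \<Longrightarrow> \<rho> \<in> complex"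
proof -
  assume "\<tau> \<in> complex" "\<rho> \<subseteq> \<tau>"
  then obtain x where "x \<in> P" "\<rho> \<subseteq> T x" by (auto simp: complex_def)
  then show ?thesis using tight_subset_realized[of x \<rho>] by (auto simp: complex_def)
qed

lemma empty_in_complex: "{} \<in> complex"
proof -
  obtain x where "x \<in> P" using cell_nonempty by blast
  then have "T x \<in> complex" by (simp add: complex_def)
  then show ?thesis by (rule complex_down) simp
qed

lemma in_complex_iff: "\<tau> \<in> complex \<longleftrightarrow> (\<exists>x\<in>P. \<tau> \<subseteq> T x)"
proof
  assume "\<exists>x\<in>P. \<tau> \<subseteq> T x"
  then show "\<tau> \<in> complex" using complex_down[of "T _" \<tau>] by (auto simp: complex_def)
qed (auto simp: complex_def)

lemma polyhedron_cell: "polyhedron P"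
proof -
  have "P = L \<inter> (\<Inter>i\<in>I. {x. a i \<bullet> x \<le> b i})" by (auto simp: cell_def)
  moreover have "polyhedron L" using subspace_L affine_imp_polyhedron subspace_imp_affine by blast
  moreover have "polyhedron (\<Inter>i\<in>I. {x. a i \<bullet> x \<le> b i})"
    using finite_I by (intro polyhedron_Inter) (auto intro: polyhedron_halfspace_le)
  ultimately show ?thesis by simp
qed

lemma polytope_cell: "polytope P"
  using polyhedron_cell bounded_cell polytope_eq_bounded_polyhedron by blast

lemma convex_cell: "convex P" and compact_cell: "compact P"
  using polytope_cell polytope_imp_convex polytope_imp_compact by auto

lemma face_of_cell:
  assumes "\<tau> \<subseteq> I"
  shows "face \<tau> face_of P"
proof (cases "\<tau> = {}")
  case True
  then show ?thesis using face_of_refl[OF convex_cell] by (simp add: face_def)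
next
  case False
  have "face \<tau> = (\<Inter>i\<in>\<tau>. P \<inter> {x. a i \<bullet> x = b i})"
    using False assms by (auto simp: face_def tight_def)
  moreover have "P \<inter> {x. a i \<bullet> x = b i} face_of P" if "i \<in> \<tau>" for i
    using that assms
    by (intro face_of_Int_supporting_hyperplane_le convex_cell) (auto simp: cell_def)
  ultimately show ?thesis
    using False face_of_Inter[of "(\<lambda>i. P \<inter> {x. a i \<bullet> x = b i}) ` \<tau>" P] by auto
qed

text \<open>Near \<open>x\<close> the face agrees with the affine space through \<open>x\<close> on
  which the tight inequalities are equalities. So this space is its affine hull, and independence of
  the normals makes its codimension in \<open>L\<close> equal to \<open>card (T x)\<close>.\<close>

lemma face_dimension:
  assumes x: "x \<in> P"
  shows "aff_dim (face (T x)) = int (dim L) - int (card (T x))" "x \<in> rel_interior (face (T x))"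
    "card (T x) \<le> dim L"
proof -
  define V where "V = {y \<in> L. \<forall>i\<in>T x. a i \<bullet> y = 0}"
  define A where "A = (+) x ` V"
  have V: "subspace V"
    using subspace_L unfolding V_def subspace_def by (auto simp: inner_add_right)
  have A: "affine A" unfolding A_def
    using V affine_translation subspace_imp_affine by blast
  have spL: "span (a ` T x) \<subseteq> L"
    using tight_subset normals_in_L by (intro span_minimal subspace_L) auto
  have "V = {y \<in> L. \<forall>z\<in>span (a ` T x). orthogonal z y}"
    unfolding V_def
  proof safe
    fix y z assume "\<forall>i\<in>T x. a i \<bullet> y = 0" "z \<in> span (a ` T x)"
    then have "orthogonal y z"
      by (intro orthogonal_to_span[of z "a ` T x" y]) (auto simp: orthogonal_def inner_commute)
    then show "orthogonal z y" by (simp add: orthogonal_commute)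
  next
    fix y i assume "\<forall>z\<in>span (a ` T x). orthogonal z y" "i \<in> T x"
    then show "a i \<bullet> y = 0" by (auto simp: orthogonal_def span_base)
  qed
  then have "dim V + dim (span (a ` T x)) = dim L"
    using dim_subspace_orthogonal_to_vectors[OF subspace_span subspace_L spL] by simp
  moreover have "dim (span (a ` T x)) = card (T x)"
    using independent_normals[OF x] inj_normals[OF x]
    by (simp add: dim_eq_card_independent card_image)
  ultimately have dV: "dim V + card (T x) = dim L" by simp
  have fA: "face (T x) \<subseteq> A"
  proof
    fix y assume y: "y \<in> face (T x)"
    have "y - x \<in> V"
      using y x subspace_L
      by (auto simp: V_def face_def cell_def inner_diff_right subspace_diff)
        (auto simp: tight_def)
    then show "y \<in> A" unfolding A_def by (intro image_eqI[of _ _ "y - x"]) auto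
  qed
  have Af: "A \<inter> slack x \<subseteq> face (T x)"
  proof
    fix y assume y: "y \<in> A \<inter> slack x"
    then obtain z where z: "y = x + z" "z \<in> V" by (auto simp: A_def)
    have eq: "a i \<bullet> y = b i" if "i \<in> T x" for i
      using that z by (auto simp: V_def inner_add_right tight_def)
    have "a i \<bullet> y \<le> b i" if "i \<in> I" for i
      using that eq[of i] y by (cases "i \<in> T x") (auto simp: slack_def less_imp_le)
    moreover have "y \<in> L" using z x subspace_L by (auto simp: V_def cell_def subspace_add)
    ultimately show "y \<in> face (T x)"
      using eq tight_subset[of x] by (auto simp: face_def cell_def tight_def)
  qed
  have xA: "x \<in> A" unfolding A_def using subspace_0[OF V] by force
  have "A \<inter> slack x \<noteq> {}" using xA in_slack[OF x] by auto
  then have "affine hull (A \<inter> slack x) = A"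
    using affine_hull_affine_Int_open[OF A open_slack, of x] hull_same[of affine A] A by simp
  then have hull: "affine hull (face (T x)) = A"
    using hull_mono[OF Af, of affine] hull_minimal[OF fA, of affine] A by (metis subset_antisym)
  have "aff_dim (face (T x)) = aff_dim A"
    using hull by (metis aff_dim_affine_hull)
  also have "\<dots> = int (dim V)"
    unfolding A_def using V by (simp add: aff_dim_translation_eq aff_dim_subspace)
  finally show "aff_dim (face (T x)) = int (dim L) - int (card (T x))" using dV by linarith
  show "card (T x) \<le> dim L" using dV by linarith
  obtain e where e: "e > 0" "ball x e \<subseteq> slack x"
    using open_slack in_slack[OF x] open_contains_ball by blast
  show "x \<in> rel_interior (face (T x))"
    unfolding mem_rel_interior_ball hull using e Af x by (auto simp: face_def)
qed

text \<open>A point with tight set \<tau> lies in \<open>face \<rho>\<close> only if \<rho>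
  \<subseteq> \<tau>, so equal faces have mutually included index sets.\<close>

lemma face_inj: "inj_on face complex"
proof (rule inj_onI)
  fix \<tau> \<rho> assume "\<tau> \<in> complex" "\<rho> \<in> complex" and eq: "face \<tau> = face \<rho>"
  then obtain x y where xy: "x \<in> P" "\<tau> = T x" "y \<in> P" "\<rho> = T y" by (auto simp: complex_def)
  then have "x \<in> face \<rho>" "y \<in> face \<tau>" using eq by (auto simp: face_def)
  then show "\<tau> = \<rho>" using xy by (auto simp: face_def)
qed

text \<open>Faces whose relative interiors meet coincide, and \<open>x\<close> is also relatively
  interior to \<open>face (T x)\<close>.\<close>

lemma face_of_imp_face:
  assumes "F face_of P" "x \<in> rel_interior F"
  shows "F = face (T x)"
proof -
  have x: "x \<in> P"
    using assms face_of_imp_subset rel_interior_subset by blast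
  show ?thesis
    using face_of_eq[OF assms(1) face_of_cell[OF tight_subset]] face_dimension(2)[OF x] assms(2)
    by blast
qed

lemma faces_of_dimension:
  assumes "k \<le> dim L"
  shows "{F. F face_of P \<and> aff_dim F = int k} = face ` {\<tau> \<in> complex. card \<tau> = dim L - k}"
proof safe
  fix F assume F: "F face_of P" "aff_dim F = int k"
  then have "rel_interior F \<noteq> {}"
    using rel_interior_eq_empty[of F] face_of_imp_convex[of F] by auto
  then obtain x where x: "x \<in> rel_interior F" by blast
  then have xP: "x \<in> P" using F face_of_imp_subset rel_interior_subset by blast
  have "F = face (T x)" using face_of_imp_face[OF F(1) x] .
  moreover have "card (T x) = dim L - k"
    using face_dimension(1,3)[OF xP] F(2) calculation by simp
  ultimately show "F \<in> face ` {\<tau> \<in> complex. card \<tau> = dim L - k}"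
    using xP by (auto simp: complex_def)
next
  fix \<tau> assume t: "\<tau> \<in> complex" "card \<tau> = dim L - k"
  then obtain x where x: "x \<in> P" "\<tau> = T x" by (auto simp: complex_def)
  show "face \<tau> face_of P" using face_of_cell complex_subset t by auto
  show "aff_dim (face \<tau>) = int k" using face_dimension(1)[OF x(1)] t(2) x(2) assms by simp
qed

lemma num_faces_cell:
  assumes "k \<le> dim L"
  shows "num_faces k P = card {\<tau> \<in> complex. card \<tau> = dim L - k}"
  unfolding num_faces_def faces_of_dimension[OF assms]
  using face_inj by (intro card_image) (auto simp: inj_on_def)

lemma aff_dim_cell: "aff_dim P = int (dim L)"
proof -
  obtain x where x: "x \<in> P" "T x = {}" using empty_in_complex by (auto simp: complex_def)
  then show ?thesis using face_dimension(1)[OF x(1)] by (simp add: face_def)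
qed

text \<open>A vertex \<open>v\<close> is the zero-dimensional face \<open>face (T v)\<close>, which
  forces \<open>card (T v) = dim L\<close>; the facets through it are the distinct sets
  \<open>face {i}\<close> with \<open>i\<close> in \<open>T v\<close>.\<close>

lemma simple_d_polytope_cell:
  assumes "dim L \<ge> 1"
  shows "simple_d_polytope (dim L) P"
  unfolding simple_d_polytope_def d_polytope_def
proof (intro conjI allI impI polytope_cell aff_dim_cell)
  fix v assume "v extreme_point_of P"
  then have v: "{v} face_of P" by (simp add: face_of_singleton)
  then have vP: "v \<in> P" using face_of_imp_subset by blast
  have "{v} = face (T v)" using face_of_imp_face[OF v, of v] by simp
  then have card: "card (T v) = dim L"
    using face_dimension(1,3)[OF vP] aff_dim_sing[of v] by simp
  have "{F. F facet_of P \<and> v \<in> F} = {F \<in> {F. F face_of P \<and> aff_dim F = int (dim L - 1)}. v \<in> F}"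
    using assms by (auto simp: facet_of_def aff_dim_cell of_nat_diff)
  also have "\<dots> = {F \<in> face ` {\<tau> \<in> complex. card \<tau> = dim L - (dim L - 1)}. v \<in> F}"
    by (subst faces_of_dimension) auto
  also have "\<dots> = (\<lambda>i. face {i}) ` T v"
  proof safe
    fix \<tau> assume "card \<tau> = dim L - (dim L - 1)" "v \<in> face \<tau>"
    then have "card \<tau> = 1" "\<tau> \<subseteq> T v" using assms by (auto simp: face_def)
    then show "face \<tau> \<in> (\<lambda>i. face {i}) ` T v" by (auto simp: card_1_singleton_iff)
  next
    fix i assume i: "i \<in> T v"
    then show "face {i} \<in> face ` {\<tau> \<in> complex. card \<tau> = dim L - (dim L - 1)}"
      using vP assms by (intro imageI) (auto simp: in_complex_iff)
    show "v \<in> face {i}" using i vP by (auto simp: face_def)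
  qed
  finally have "{F. F facet_of P \<and> v \<in> F} = (\<lambda>i. face {i}) ` T v" .
  moreover have "inj_on (\<lambda>i. face {i}) (T v)"
  proof (rule inj_onI)
    fix i j assume "i \<in> T v" "j \<in> T v" "face {i} = face {j}"
    then show "i = j" using inj_onD[OF face_inj, of "{i}" "{j}"] vP by (auto simp: in_complex_iff)
  qed
  ultimately show "card {F. F facet_of P \<and> v \<in> F} = dim L"
    using card by (simp add: card_image)
qed

section \<open>Truncating a face\<close>

lemma tight_open_segment:
  assumes "x \<in> P" "y \<in> P" "0 < t" "t < 1"
  shows "(1 - t) *\<^sub>R x + t *\<^sub>R y \<in> P" "T ((1 - t) *\<^sub>R x + t *\<^sub>R y) = T x \<inter> T y"
proof -
  let ?z = "(1 - t) *\<^sub>R x + t *\<^sub>R y"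
  show "?z \<in> P" using convexD[OF convex_cell assms(1,2)] assms(3,4) by auto
  \<comment> \<open>The slack of an inequality is affine and nonnegative on the segment, so it
    vanishes inside only if it vanishes at both ends.\<close>
  have "a i \<bullet> ?z = b i \<longleftrightarrow> a i \<bullet> x = b i \<and> a i \<bullet> y = b i" if "i \<in> I" for i
  proof -
    have le: "a i \<bullet> x \<le> b i" "a i \<bullet> y \<le> b i" using assms that by (auto simp: cell_def)
    have eq: "b i - a i \<bullet> ?z = (1 - t) * (b i - a i \<bullet> x) + t * (b i - a i \<bullet> y)"
      by (simp add: inner_add_right algebra_simps)
    have "(1 - t) * (b i - a i \<bullet> x) + t * (b i - a i \<bullet> y) = 0
        \<longleftrightarrow> (1 - t) * (b i - a i \<bullet> x) = 0 \<and> t * (b i - a i \<bullet> y) = 0"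
      using le assms(3,4) by (intro add_nonneg_eq_0_iff mult_nonneg_nonneg) auto
    also have "\<dots> \<longleftrightarrow> a i \<bullet> x = b i \<and> a i \<bullet> y = b i" using assms(3,4) by auto
    finally show ?thesis unfolding eq[symmetric] by linarith
  qed
  then show "T ?z = T x \<inter> T y" by (auto simp: tight_def)
qed

text \<open>The cut pushes the supporting hyperplane \<open>(\<Sum>i\<in>\<sigma>. a i) \<bullet> x = (\<Sum>i\<in>\<sigma>. b i)\<close> slightly inwards.\<close>

lemma truncation:
  assumes \<sigma>: "\<sigma> \<in> complex" "\<sigma> \<noteq> {}" and v: "v \<notin> I"
  shows "\<exists>a' b'. simple_system L a' b' (insert v I) \<and>
    simple_system.complex L a' b' (insert v I) = stellar \<sigma> v complex"
proof -
  define c where "c = (\<Sum>i\<in>\<sigma>. a i)"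
  define \<beta> where "\<beta> = (\<Sum>i\<in>\<sigma>. b i)"
  have \<sigma>I: "\<sigma> \<subseteq> I" using complex_subset \<sigma>(1) by blast
  have fin\<sigma>: "finite \<sigma>" using \<sigma>I finite_I finite_subset by blast
  have cx: "c \<bullet> x = (\<Sum>i\<in>\<sigma>. a i \<bullet> x)" for x by (simp add: c_def inner_sum_left)
  have c_le: "c \<bullet> x \<le> \<beta>" if "x \<in> P" for x
    unfolding cx \<beta>_def using that \<sigma>I by (intro sum_mono) (auto simp: cell_def)
  have c_eq: "c \<bullet> x = \<beta> \<longleftrightarrow> \<sigma> \<subseteq> T x" if "x \<in> P" for x
  proof
    assume "c \<bullet> x = \<beta>"
    then have "(\<Sum>i\<in>\<sigma>. a i \<bullet> x) = (\<Sum>i\<in>\<sigma>. b i)" by (simp add: cx \<beta>_def)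
    then have "a i \<bullet> x = b i" if "i \<in> \<sigma>" for i
      using sum_mono_inv[of "\<lambda>i. a i \<bullet> x" \<sigma> b i] that \<open>x \<in> P\<close> \<sigma>I fin\<sigma> by (auto simp: cell_def)
    then show "\<sigma> \<subseteq> T x" using \<sigma>I by (auto simp: tight_def)
  next
    assume "\<sigma> \<subseteq> T x"
    then show "c \<bullet> x = \<beta>" unfolding cx \<beta>_def by (intro sum.cong) (auto simp: tight_def)
  qed
  define K where "K = {\<tau> \<in> complex. \<not> \<sigma> \<subseteq> \<tau>}"
  \<comment> \<open>Two smallness conditions on the cut: it leaves a point with tight set \<tau>
    strictly on the kept side, and it misses \<open>face \<tau>\<close> entirely if that face is
    disjoint from \<open>face \<sigma>\<close>.\<close>
  define good where "good = (\<lambda>\<epsilon> \<tau>. (\<exists>x\<in>P. T x = \<tau> \<and> c \<bullet> x < \<beta> - \<epsilon>) \<and>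
      (\<tau> \<union> \<sigma> \<notin> complex \<longrightarrow> (\<forall>y\<in>face \<tau>. c \<bullet> y < \<beta> - \<epsilon>)))"
  have "\<forall>\<^sub>F \<epsilon> in at_right 0. good \<epsilon> \<tau>" if \<tau>: "\<tau> \<in> K" for \<tau>
  proof -
    obtain x where x: "x \<in> P" "T x = \<tau>" using \<tau> by (auto simp: K_def complex_def)
    have "c \<bullet> x < \<beta>" using c_le[OF x(1)] c_eq[OF x(1)] x \<tau> by (auto simp: K_def)
    then have ev1: "\<forall>\<^sub>F \<epsilon> in at_right 0. \<epsilon> < \<beta> - c \<bullet> x"
      by (intro order_tendstoD(2)[OF tendsto_ident_at]) auto
    have ev2: "\<forall>\<^sub>F \<epsilon> in at_right 0. \<tau> \<union> \<sigma> \<notin> complex \<longrightarrow> (\<forall>y\<in>face \<tau>. c \<bullet> y < \<beta> - \<epsilon>)"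
    proof (cases "\<tau> \<union> \<sigma> \<in> complex")
      case False
      \<comment> \<open>By compactness \<open>c\<close> attains its maximum on this face, and the
        maximum is below \<beta> because the face is disjoint from that of \<sigma>.\<close>
      have "compact (face \<tau>)"
        using face_of_imp_compact[OF convex_cell compact_cell face_of_cell] \<tau> complex_subset
        by (auto simp: K_def)
      moreover have "face \<tau> \<noteq> {}" using x by (auto simp: face_def)
      ultimately obtain y where y: "y \<in> face \<tau>" "\<forall>z\<in>face \<tau>. c \<bullet> z \<le> c \<bullet> y"
        using continuous_attains_sup[of "face \<tau>" "\<lambda>z. c \<bullet> z"]
          continuous_on_inner[OF continuous_on_const continuous_on_id] by blast
      have yP: "y \<in> P" "\<tau> \<subseteq> T y" using y by (auto simp: face_def)
      then have "\<not> \<sigma> \<subseteq> T y" using False unfolding in_complex_iff by blast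
      then have "c \<bullet> y < \<beta>" using c_le[OF yP(1)] c_eq[OF yP(1)] by auto
      then have "\<forall>\<^sub>F \<epsilon> in at_right 0. \<epsilon> < \<beta> - c \<bullet> y"
        by (intro order_tendstoD(2)[OF tendsto_ident_at]) auto
      then show ?thesis using y(2) by (auto elim!: eventually_mono)
    qed simp
    show ?thesis using ev1 ev2
      by eventually_elim (use x in \<open>auto simp: good_def intro!: bexI[of _ x]\<close>)
  qed
  moreover have "finite K" using finite_complex by (auto simp: K_def)
  ultimately have "\<forall>\<^sub>F \<epsilon> in at_right (0::real). \<forall>\<tau>\<in>K. good \<epsilon> \<tau>"
    by (intro eventually_ball_finite) auto
  then have "\<forall>\<^sub>F \<epsilon> in at_right (0::real). (\<forall>\<tau>\<in>K. good \<epsilon> \<tau>) \<and> \<epsilon> > 0"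
    by (intro eventually_conj eventually_at_right_less)
  then obtain \<epsilon> :: real where \<epsilon>: "\<epsilon> > 0" "\<And>\<tau>. \<tau> \<in> K \<Longrightarrow> good \<epsilon> \<tau>"
    using eventually_happens[of _ "at_right (0::real)"] trivial_limit_at_right_real by blast
  define a' where "a' = a(v := c)"
  define b' where "b' = b(v := \<beta> - \<epsilon>)"
  let ?P = "cell L a' b' (insert v I)" and ?T = "tight a' b' (insert v I)"
  have P': "?P = {x \<in> P. c \<bullet> x \<le> \<beta> - \<epsilon>}"
    using v by (auto simp: cell_def a'_def b'_def)
  have T': "?T x = (if c \<bullet> x = \<beta> - \<epsilon> then insert v (T x) else T x)" for x
    using v by (auto simp: tight_def a'_def b'_def)
  have inK: "T x \<in> K" if "x \<in> ?P" for x
    using that c_eq[of x] \<epsilon>(1) by (auto simp: P' K_def complex_def)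
  \<comment> \<open>A point on the new hyperplane lies in a face meeting that of \<sigma>; otherwise
    the second clause of \<open>good\<close> would put it strictly below.\<close>
  have star: "T x \<union> \<sigma> \<in> complex" if "x \<in> ?P" "c \<bullet> x = \<beta> - \<epsilon>" for x
    using \<epsilon>(2)[OF inK[OF that(1)]] that by (auto simp: good_def face_def P')
  have a'T: "a' ` T x = a ` T x" "inj_on a' (T x) \<longleftrightarrow> inj_on a (T x)" for x
    using v tight_subset[of x] by (auto simp: a'_def inj_on_def)
  have c_span: "c \<notin> span (a ` T x)" if x: "x \<in> ?P" "c \<bullet> x = \<beta> - \<epsilon>" for x
  proof
    assume cs: "c \<in> span (a ` T x)"
    \<comment> \<open>At a point \<open>y\<close> where \<open>T x\<close> and \<sigma> are both
      tight, solving \<open>c\<close> for some \<open>a j\<close> with \<open>j\<close> outside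
      \<open>T x\<close> contradicts independence of the normals at \<open>y\<close>.\<close>
    obtain y where y: "y \<in> P" "T x \<union> \<sigma> \<subseteq> T y" using star[OF x] in_complex_iff by auto
    obtain j where j: "j \<in> \<sigma>" "j \<notin> T x" using inK[OF x(1)] by (auto simp: K_def)
    let ?S = "T x \<union> (\<sigma> - {j})"
    have "c = a j + (\<Sum>i\<in>\<sigma> - {j}. a i)"
      unfolding c_def using fin\<sigma> j(1) by (rule sum.remove)
    moreover have "(\<Sum>i\<in>\<sigma> - {j}. a i) \<in> span (a ` ?S)"
      by (intro span_sum span_base) auto
    moreover have "c \<in> span (a ` ?S)" using cs span_mono[of "a ` T x" "a ` ?S"] by auto
    ultimately have "a j \<in> span (a ` ?S)"
      by (metis add_diff_cancel_right' span_diff)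
    then show False using normal_not_in_span[OF y(1), of ?S j] y(2) j by auto
  qed
  have sys: "simple_system L a' b' (insert v I)"
  proof
    show "a' i \<in> L" if "i \<in> insert v I" for i
      using that normals_in_L \<sigma>I by (auto simp: a'_def c_def intro!: subspace_sum subspace_L)
    show "bounded ?P" using bounded_cell by (rule bounded_subset) (auto simp: P')
    have "{} \<in> K" using empty_in_complex \<sigma> by (auto simp: K_def)
    then show "?P \<noteq> {}" using \<epsilon>(2)[of "{}"] by (force simp: good_def P')
    fix x assume x: "x \<in> ?P"
    then have xP: "x \<in> P" by (auto simp: P')
    have a'v: "a' v = c" and vT: "v \<notin> T x" using v tight_subset[of x] by (auto simp: a'_def)
    show "inj_on a' (?T x)"
    proof (cases "c \<bullet> x = \<beta> - \<epsilon>")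
      case True
      then have "c \<notin> a ` T x" using c_span[OF x] span_base[of c "a ` T x"] by auto
      then show ?thesis
        using True inj_normals[OF xP] vT a'T[of x] by (simp add: T' inj_on_insert a'v)
    qed (use inj_normals[OF xP] a'T[of x] in \<open>simp add: T'\<close>)
    show "independent (a' ` ?T x)"
      using a'T(1)[of x] independent_normals[OF xP] c_span[OF x]
      by (simp add: T' a'v independent_insertI)
  qed (use subspace_L finite_I in auto)
  moreover have "?T ` ?P = stellar \<sigma> v complex"
  proof
    show "?T ` ?P \<subseteq> stellar \<sigma> v complex"
      using inK star unfolding stellar_def K_def by (auto simp: T')
    have "\<tau> \<in> ?T ` ?P" if "\<tau> \<in> K" for \<tau>
      using \<epsilon>(2)[OF that] by (auto simp: good_def P' T' image_iff)
    moreover have "insert v \<tau> \<in> ?T ` ?P" if \<tau>: "\<tau> \<in> K" "\<tau> \<union> \<sigma> \<in> complex" for \<tau>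
    proof -
      obtain x where x: "x \<in> P" "T x = \<tau>" "c \<bullet> x < \<beta> - \<epsilon>"
        using \<epsilon>(2)[OF \<tau>(1)] by (auto simp: good_def)
      obtain y where y: "y \<in> P" "T y = \<tau> \<union> \<sigma>" using \<tau>(2) by (auto simp: complex_def)
      have cy: "c \<bullet> y = \<beta>" using c_eq[OF y(1)] y(2) by auto
      \<comment> \<open>The segment runs from a point with tight set \<tau> below the new hyperplane
        to one with tight set \<tau> \<union> \<sigma> above it; \<open>t\<close> is the parameter
        of the crossing, where the old tight set is still \<tau>.\<close>
      define t where "t = (\<beta> - \<epsilon> - c \<bullet> x) / (\<beta> - c \<bullet> x)"
      have pos: "\<beta> - c \<bullet> x > 0" using x(3) \<epsilon>(1) by linarith
      then have t: "0 < t" "t < 1" using x(3) \<epsilon>(1) by (auto simp: t_def)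
      let ?z = "(1 - t) *\<^sub>R x + t *\<^sub>R y"
      have "c \<bullet> ?z = c \<bullet> x + t * (\<beta> - c \<bullet> x)"
        by (simp add: inner_add_right cy algebra_simps)
      then have cz: "c \<bullet> ?z = \<beta> - \<epsilon>" using pos by (simp add: t_def)
      have "T ?z = \<tau>" "?z \<in> P" using tight_open_segment[OF x(1) y(1) t] x(2) y(2) by auto
      then show ?thesis using cz by (intro image_eqI[of _ _ ?z]) (auto simp: T' P')
    qed
    ultimately show "stellar \<sigma> v complex \<subseteq> ?T ` ?P"
      unfolding stellar_def K_def by blast
  qed
  ultimately show ?thesis by (metis simple_system.complex_def)
qed

end

section \<open>The simplex as starting system\<close>

lemma simplex_system:
  fixes d :: nat
  assumes "d \<le> DIM('a::euclidean_space)"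
  shows "\<exists>(L::'a set) a b. simple_system L a b {..d} \<and> dim L = d \<and>
    simple_system.complex L a b {..d} = {\<tau>. \<tau> \<subset> {..d}}"
proof -
  obtain B :: "'a set" where B: "B \<subseteq> Basis" "card B = d"
    using assms obtain_subset_with_card_n by blast
  then have finB: "finite B" using finite_Basis finite_subset by blast
  then obtain e where e: "bij_betw e {..<d} B"
    using ex_bij_betw_nat_finite[OF finB] B(2) by (auto simp: atLeast0LessThan)
  then have eB: "e i \<in> B" if "i < d" for i using that by (auto simp: bij_betw_def)
  have ee: "e i \<bullet> e j = (if i = j then 1 else 0)" if "i < d" "j < d" for i j
  proof -
    have "e i = e j \<longleftrightarrow> i = j" using that e by (auto simp: bij_betw_def inj_on_def)
    then show ?thesis using eB that B(1) by (auto simp: inner_Basis subset_iff)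
  qed
  define s where "s = (\<Sum>i<d. e i)"
  have se: "s \<bullet> e j = 1" if "j < d" for j
  proof -
    have "s \<bullet> e j = (\<Sum>i<d. if i = j then 1 else 0)"
      unfolding s_def inner_sum_left using that ee by (intro sum.cong) auto
    then show ?thesis using that by simp
  qed
  define L where "L = span B"
  \<comment> \<open>Standard simplex in \<open>span B\<close>: indices below \<open>d\<close> are
    the coordinate inequalities, and index \<open>d\<close> bounds the coordinate sum.\<close>
  define a where "a = (\<lambda>i. if i < d then - e i else s)"
  define b :: "nat \<Rightarrow> real" where "b = (\<lambda>i. if i < d then 0 else 1)"
  let ?P = "cell L a b {..d}" and ?T = "tight a b {..d}"
  have P: "x \<in> ?P \<longleftrightarrow> x \<in> L \<and> (\<forall>i<d. e i \<bullet> x \<ge> 0) \<and> s \<bullet> x \<le> 1" for x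
    by (auto simp: cell_def a_def b_def atMost_def le_less)
  have T: "i \<in> ?T x \<longleftrightarrow> (i < d \<and> e i \<bullet> x = 0) \<or> (i = d \<and> s \<bullet> x = 1)" for x i
    by (auto simp: tight_def a_def b_def)
  have sx: "s \<bullet> x = (\<Sum>i<d. e i \<bullet> x)" for x by (simp add: s_def inner_sum_left)
  have T_proper: "?T x \<subset> {..d}" for x
  proof -
    have "?T x \<noteq> {..d}"
    proof
      assume all: "?T x = {..d}"
      then have "e i \<bullet> x = 0" if "i < d" for i using T[of i x] that by auto
      then have "s \<bullet> x = 0" by (simp add: sx)
      moreover have "s \<bullet> x = 1" using T[of d x] all by auto
      ultimately show False by simp
    qed
    then show ?thesis by (auto simp: tight_def)
  qed
  have realized: "\<exists>x\<in>?P. ?T x = \<tau>" if \<tau>: "\<tau> \<subset> {..d}" for \<tau>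
  proof -
    define N where "N = real (card ({..d} - \<tau>))"
    have "card ({..d} - \<tau>) > 0" using \<tau> by (auto simp: card_gt_0_iff)
    then have N: "N > 0" by (simp add: N_def)
    \<comment> \<open>The barycenter of the face on which \<tau> is tight: its \<open>N\<close>
      vertices are the \<open>e i\<close> with \<open>i < d\<close> outside \<tau>, and the origin
      if \<open>d\<close> is outside \<tau>.\<close>
    define x where "x = (\<Sum>i\<in>{..<d} - \<tau>. (1 / N) *\<^sub>R e i)"
    have ex: "e j \<bullet> x = (if j \<in> \<tau> then 0 else 1 / N)" if "j < d" for j
    proof -
      have "e j \<bullet> x = (\<Sum>i\<in>{..<d} - \<tau>. if i = j then 1 / N else 0)"
        unfolding x_def inner_sum_right using that ee by (intro sum.cong) auto
      then show ?thesis using that by simp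
    qed
    have "s \<bullet> x = (\<Sum>i\<in>{..<d} - \<tau>. 1 / N)"
      unfolding sx using ex by (intro sum.mono_neutral_cong_right) auto
    then have sx': "s \<bullet> x = real (card ({..<d} - \<tau>)) / N" by simp
    have s1: "s \<bullet> x \<le> 1 \<and> (s \<bullet> x = 1 \<longleftrightarrow> d \<in> \<tau>)"
    proof (cases "d \<in> \<tau>")
      case True
      then have "{..d} - \<tau> = {..<d} - \<tau>" by (auto simp: le_less)
      then have "s \<bullet> x = N / N" using sx' by (simp only: N_def)
      then show ?thesis using True N by simp
    next
      case False
      then have "{..d} - \<tau> = insert d ({..<d} - \<tau>)" by auto
      then have "N = real (card ({..<d} - \<tau>)) + 1" by (simp add: N_def)
      then have "s \<bullet> x < 1" using N sx' by (simp add: divide_less_eq)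
      then show ?thesis using False by simp
    qed
    have "x \<in> L" unfolding x_def L_def
      using eB by (intro span_sum span_scale span_base) auto
    then have "x \<in> ?P" using ex s1 N by (simp add: P)
    moreover have "?T x = \<tau>"
    proof (rule set_eqI)
      fix i show "i \<in> ?T x \<longleftrightarrow> i \<in> \<tau>"
        using \<tau> ex[of i] s1 N by (cases "i < d") (auto simp: T le_less)
    qed
    ultimately show ?thesis by blast
  qed
  have indep: "inj_on a \<tau> \<and> independent (a ` \<tau>)" if \<tau>: "\<tau> \<subset> {..d}" for \<tau>
  proof -
    define \<tau>' where "\<tau>' = \<tau> - {d}"
    have lt: "i < d" if "i \<in> \<tau>'" for i using that \<tau> by (auto simp: \<tau>'_def le_less)
    have aa: "a i \<bullet> a j = (if i = j then 1 else 0)" if "i \<in> \<tau>'" "j \<in> \<tau>'" for i j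
      using lt that ee by (auto simp: a_def)
    have inj: "inj_on a \<tau>'"
    proof (rule inj_onI)
      fix i j assume "i \<in> \<tau>'" "j \<in> \<tau>'" "a i = a j"
      then show "i = j" using aa[of i j] aa[of j j] by (auto split: if_splits)
    qed
    have ind: "independent (a ` \<tau>')"
    proof (rule pairwise_orthogonal_independent)
      show "pairwise orthogonal (a ` \<tau>')"
        using aa by (auto simp: pairwise_def orthogonal_def)
      have "a i \<noteq> 0" if "i \<in> \<tau>'" for i using aa[OF that that] by auto
      then show "0 \<notin> a ` \<tau>'" by auto
    qed
    show ?thesis
    proof (cases "d \<in> \<tau>")
      case False
      then show ?thesis using inj ind by (simp add: \<tau>'_def)
    next
      case True
      obtain j where "j \<in> {..d}" and j: "j \<notin> \<tau>" using psubset_imp_ex_mem[OF \<tau>] by auto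
      moreover have "j \<noteq> d" using True j by auto
      ultimately have j: "j < d" "j \<notin> \<tau>" by auto
      \<comment> \<open>For an index \<open>j\<close> missing from \<tau>, the vector
        \<open>e j\<close> is orthogonal to the other normals but not to \<open>s\<close>.\<close>
      have s_span: "s \<notin> span (a ` \<tau>')"
      proof
        assume "s \<in> span (a ` \<tau>')"
        then have "orthogonal (e j) s"
        proof (rule orthogonal_to_span)
          fix y assume "y \<in> a ` \<tau>'"
          then obtain i where i: "i \<in> \<tau>'" "y = a i" by auto
          then have "i < d" "i \<noteq> j" using lt j by (auto simp: \<tau>'_def)
          then show "orthogonal (e j) y" using i ee[of j i] j by (simp add: a_def orthogonal_def)
        qed
        then show False using se[OF j(1)] by (simp add: orthogonal_def inner_commute)
      qed
      have "\<tau> = insert d \<tau>'" "d \<notin> \<tau>'" "a d = s" using True by (auto simp: \<tau>'_def a_def)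
      moreover have "s \<notin> a ` \<tau>'" using s_span span_base[of s "a ` \<tau>'"] by auto
      ultimately show ?thesis
        using inj ind s_span independent_insertI[OF s_span ind]
        by (simp add: inj_on_insert \<open>d \<notin> \<tau>'\<close>)
    qed
  qed
  have sys: "simple_system L a b {..d}"
  proof
    show "a i \<in> L" for i
    proof -
      have "s \<in> L" unfolding s_def L_def using eB by (intro span_sum span_base) auto
      then show ?thesis using eB by (auto simp: a_def L_def span_neg span_base)
    qed
    show "?P \<noteq> {}" using realized[of "{}"] by auto
    have "norm x \<le> 1" if x: "x \<in> ?P" for x
    proof -
      \<comment> \<open>On the cell the coordinates are nonnegative, so the l1 norm of
        \<open>x\<close> is \<open>s \<bullet> x\<close>.\<close>
      have "norm x \<le> (\<Sum>u\<in>Basis. \<bar>x \<bullet> u\<bar>)" by (rule norm_le_l1)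
      also have "\<dots> = (\<Sum>u\<in>B. \<bar>x \<bullet> u\<bar>)"
      proof (rule sum.mono_neutral_right)
        show "\<forall>u\<in>Basis - B. \<bar>x \<bullet> u\<bar> = 0"
        proof
          fix u assume u: "u \<in> Basis - B"
          have "x \<in> span B" using x unfolding P by (simp add: L_def)
          then have "orthogonal u x"
            using u B(1) by (intro orthogonal_to_span[of x B])
              (auto simp: orthogonal_def inner_Basis subset_iff)
          then show "\<bar>x \<bullet> u\<bar> = 0" by (simp add: orthogonal_def inner_commute)
        qed
      qed (use B in auto)
      also have "\<dots> = (\<Sum>i<d. \<bar>x \<bullet> e i\<bar>)"
        by (rule sum.reindex_bij_betw[OF e, symmetric])
      also have "\<dots> = s \<bullet> x"
        unfolding sx using x by (intro sum.cong) (auto simp: P inner_commute)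
      also have "\<dots> \<le> 1" using x by (simp add: P)
      finally show ?thesis .
    qed
    then show "bounded ?P" unfolding bounded_iff by blast
  qed (use indep[OF T_proper] in \<open>auto simp: L_def\<close>)
  moreover have "dim L = d"
    using B by (simp add: L_def dim_eq_card_independent independent_mono[OF independent_Basis])
  moreover have "?T ` ?P = {\<tau>. \<tau> \<subset> {..d}}"
  proof
    show "?T ` ?P \<subseteq> {\<tau>. \<tau> \<subset> {..d}}" using T_proper by blast
    show "{\<tau>. \<tau> \<subset> {..d}} \<subseteq> ?T ` ?P"
    proof
      fix \<tau> assume "\<tau> \<in> {\<tau>. \<tau> \<subset> {..d}}"
      then show "\<tau> \<in> ?T ` ?P" using realized[of \<tau>] by fast
    qed
  qed
  ultimately show ?thesis by (metis simple_system.complex_def)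
qed

section \<open>Simplex faces, their truncation, and the effect on face numbers\<close>

text \<open>
  \<open>simplex_link \<Delta> \<sigma> \<rho>\<close>: the link of \<open>\<sigma>\<close> in \<open>\<Delta>\<close> is the boundary complex of the
  simplex \<open>\<rho>\<close>. If \<open>\<rho>\<close> is a singleton, the link is \<open>{{}}\<close> and the point of \<open>\<rho>\<close> need
  not be a vertex of \<open>\<Delta>\<close>.
\<close>

definition simplex_link :: "'v set set \<Rightarrow> 'v set \<Rightarrow> 'v set \<Rightarrow> bool" where
  "simplex_link \<Delta> \<sigma> \<rho> \<longleftrightarrow> \<sigma> \<inter> \<rho> = {} \<and> (\<forall>\<tau>. \<tau> \<union> \<sigma> \<in> \<Delta> \<longleftrightarrow> \<tau> \<subseteq> \<sigma> \<union> \<rho> \<and> \<not> \<rho> \<subseteq> \<tau>)"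

text \<open>The star of \<sigma> is the join of \<sigma> with the boundary of \<rho>, so after
  subdivision the link of \<open>v\<close> is the join of the boundaries of \<sigma> and \<rho>.
  There \<open>\<rho> - {p}\<close> is a facet of the second factor, and
  \<open>\<sigma> - \<rho>'\<close> has the boundary of \<rho>' as its link in the first.\<close>

lemma simplex_link_stellar:
  assumes link: "simplex_link \<Delta> \<sigma> \<rho>" and down: "\<And>\<tau> \<tau>'. \<tau> \<in> \<Delta> \<Longrightarrow> \<tau>' \<subseteq> \<tau> \<Longrightarrow> \<tau>' \<in> \<Delta>"
    and v: "v \<notin> \<Union>\<Delta>" "v \<notin> \<sigma> \<union> \<rho>" and p: "p \<in> \<rho>" and \<rho>': "\<rho>' \<subseteq> \<sigma>"
  shows "simplex_link (stellar \<sigma> v \<Delta>) (insert v ((\<sigma> - \<rho>') \<union> (\<rho> - {p}))) \<rho>'"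
proof -
  have disj: "\<sigma> \<inter> \<rho> = {}" and star: "\<And>\<tau>. \<tau> \<union> \<sigma> \<in> \<Delta> \<longleftrightarrow> \<tau> \<subseteq> \<sigma> \<union> \<rho> \<and> \<not> \<rho> \<subseteq> \<tau>"
    using link by (auto simp: simplex_link_def)
  define \<sigma>' where "\<sigma>' = insert v ((\<sigma> - \<rho>') \<union> (\<rho> - {p}))"
  have "\<tau> \<union> \<sigma>' \<in> stellar \<sigma> v \<Delta> \<longleftrightarrow> \<tau> \<subseteq> \<sigma>' \<union> \<rho>' \<and> \<not> \<rho>' \<subseteq> \<tau>" for \<tau>
  proof -
    define X where "X = (\<tau> - {v}) \<union> (\<sigma> - \<rho>') \<union> (\<rho> - {p})"
    have X: "\<tau> \<union> \<sigma>' = insert v X" "v \<notin> X" using v by (auto simp: X_def \<sigma>'_def)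
    have "insert v X \<in> stellar \<sigma> v \<Delta> \<longleftrightarrow> X \<in> \<Delta> \<and> \<not> \<sigma> \<subseteq> X \<and> X \<union> \<sigma> \<in> \<Delta>"
    proof
      assume "insert v X \<in> stellar \<sigma> v \<Delta>"
      then obtain Y where Y: "insert v X = insert v Y" "Y \<in> \<Delta>" "\<not> \<sigma> \<subseteq> Y" "Y \<union> \<sigma> \<in> \<Delta>"
        using v(1) by (auto simp: stellar_def)
      then have "Y = X" using X(2) v(1) by (metis UnionI insertI1 insert_ident)
      then show "X \<in> \<Delta> \<and> \<not> \<sigma> \<subseteq> X \<and> X \<union> \<sigma> \<in> \<Delta>" using Y by auto
    qed (auto simp: stellar_def)
    also have "\<dots> \<longleftrightarrow> \<not> \<sigma> \<subseteq> X \<and> X \<union> \<sigma> \<in> \<Delta>" using down[of "X \<union> \<sigma>" X] by auto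
    also have "\<dots> \<longleftrightarrow> \<not> \<sigma> \<subseteq> X \<and> X \<subseteq> \<sigma> \<union> \<rho> \<and> \<not> \<rho> \<subseteq> X" using star by simp
    also have "\<sigma> \<subseteq> X \<longleftrightarrow> \<rho>' \<subseteq> \<tau>" using \<rho>' v disj by (auto simp: X_def)
    also have "\<rho> \<subseteq> X \<longleftrightarrow> p \<in> \<tau>" using \<rho>' v disj p by (auto simp: X_def)
    also have "X \<subseteq> \<sigma> \<union> \<rho> \<and> p \<notin> \<tau> \<longleftrightarrow> \<tau> \<subseteq> \<sigma>' \<union> \<rho>'"
      using \<rho>' v disj p by (auto simp: X_def \<sigma>'_def)
    finally show ?thesis using X(1) by auto
  qed
  moreover have "\<sigma>' \<inter> \<rho>' = {}" using \<rho>' v disj by (auto simp: \<sigma>'_def)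
  ultimately show ?thesis by (simp add: simplex_link_def \<sigma>'_def)
qed

text \<open>Passing to complements gives this form, in which the lower index exceeds the upper one
  when \<rho> has more than \<open>s\<close> elements. The variant with lower index
  \<open>s - card \<rho>\<close> would fail there under truncated subtraction.\<close>

lemma card_supersets_of_size:
  assumes U: "finite U" and \<rho>: "\<rho> \<subseteq> U" and "s \<le> card U"
  shows "card {\<tau>. \<tau> \<subseteq> U \<and> \<rho> \<subseteq> \<tau> \<and> card \<tau> = s} = (card U - card \<rho>) choose (card U - s)"
proof -
  have "bij_betw (\<lambda>\<tau>. U - \<tau>) {\<tau>. \<tau> \<subseteq> U \<and> \<rho> \<subseteq> \<tau> \<and> card \<tau> = s}
      {\<tau>. \<tau> \<subseteq> U - \<rho> \<and> card \<tau> = card U - s}"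
  proof (rule bij_betw_byWitness[where f' = "\<lambda>\<tau>. U - \<tau>"])
    show "(\<lambda>\<tau>. U - \<tau>) ` {\<tau>. \<tau> \<subseteq> U \<and> \<rho> \<subseteq> \<tau> \<and> card \<tau> = s}
        \<subseteq> {\<tau>. \<tau> \<subseteq> U - \<rho> \<and> card \<tau> = card U - s}"
      using U by (auto simp: card_Diff_subset finite_subset)
    show "(\<lambda>\<tau>. U - \<tau>) ` {\<tau>. \<tau> \<subseteq> U - \<rho> \<and> card \<tau> = card U - s}
        \<subseteq> {\<tau>. \<tau> \<subseteq> U \<and> \<rho> \<subseteq> \<tau> \<and> card \<tau> = s}"
    proof safe
      fix \<tau> assume t: "\<tau> \<subseteq> U - \<rho>" "card \<tau> = card U - s"
      then have "\<tau> \<subseteq> U" by auto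
      then have "card (U - \<tau>) = card U - card \<tau>" using U by (simp add: card_Diff_subset finite_subset)
      then show "card (U - \<tau>) = s" using t assms(3) by simp
    qed (use \<rho> in auto)
  qed auto
  then show ?thesis
    using n_subsets[of "U - \<rho>" "card U - s"] U \<rho>
    by (simp add: bij_betw_same_card card_Diff_subset finite_subset)
qed

text \<open>Members with \<open>Suc r\<close> elements are too small to contain \<sigma>, so none is
  lost. The new ones add \<open>v\<close> to an \<open>r\<close>-subset of \<sigma> \<union> \<rho>
  not containing \<rho>, counted as all \<open>r\<close>-subsets minus those containing \<rho>. The
  additive form avoids subtraction of naturals.\<close>

lemma card_stellar:
  assumes link: "simplex_link \<Delta> \<sigma> \<rho>" and down: "\<And>\<tau> \<tau>'. \<tau> \<in> \<Delta> \<Longrightarrow> \<tau>' \<subseteq> \<tau> \<Longrightarrow> \<tau>' \<in> \<Delta>"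
    and fin: "finite \<Delta>" "\<And>\<tau>. \<tau> \<in> \<Delta> \<Longrightarrow> finite \<tau>" and v: "v \<notin> \<Union>\<Delta>"
    and finU: "finite (\<sigma> \<union> \<rho>)" and r: "Suc r < card \<sigma>"
  shows "card {\<tau> \<in> stellar \<sigma> v \<Delta>. card \<tau> = Suc r} + (card \<sigma> choose (card \<sigma> + card \<rho> - r))
    = card {\<tau> \<in> \<Delta>. card \<tau> = Suc r} + ((card \<sigma> + card \<rho>) choose (card \<sigma> + card \<rho> - r))"
proof -
  have disj: "\<sigma> \<inter> \<rho> = {}" and star: "\<And>\<tau>. \<tau> \<union> \<sigma> \<in> \<Delta> \<longleftrightarrow> \<tau> \<subseteq> \<sigma> \<union> \<rho> \<and> \<not> \<rho> \<subseteq> \<tau>"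
    using link by (auto simp: simplex_link_def)
  define A where "A = {\<tau> \<in> \<Delta>. card \<tau> = Suc r}"
  define S where "S = {\<tau>. \<tau> \<subseteq> \<sigma> \<union> \<rho> \<and> \<not> \<rho> \<subseteq> \<tau> \<and> card \<tau> = r}"
  define R where "R = {\<tau>. \<tau> \<subseteq> \<sigma> \<union> \<rho> \<and> \<rho> \<subseteq> \<tau> \<and> card \<tau> = r}"
  have small: "\<not> \<sigma> \<subseteq> \<tau>" if "\<tau> \<in> \<Delta>" "card \<tau> \<le> Suc r" for \<tau>
    using that r fin(2) card_mono[of \<tau> \<sigma>] by fastforce
  have S\<Delta>: "\<tau> \<in> S \<longleftrightarrow> \<tau> \<in> \<Delta> \<and> \<tau> \<union> \<sigma> \<in> \<Delta> \<and> card \<tau> = r" for \<tau>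
    using star[of \<tau>] down[of "\<tau> \<union> \<sigma>" \<tau>] by (auto simp: S_def)
  have cv: "card (insert v \<tau>) = Suc (card \<tau>)" if "\<tau> \<in> \<Delta>" for \<tau>
    using that v fin(2) by (subst card_insert_disjoint) auto
  have "{\<tau> \<in> stellar \<sigma> v \<Delta>. card \<tau> = Suc r} = A \<union> insert v ` S"
    using small cv unfolding stellar_def A_def by (auto simp: S\<Delta>)
  moreover have "A \<inter> insert v ` S = {}" using v by (auto simp: A_def)
  moreover have "inj_on (insert v) S"
    using v by (intro inj_onI) (metis S\<Delta> UnionI insert_ident)
  moreover have "finite A" "finite S" "finite R"
    using fin finU by (auto simp: A_def S_def R_def)
  ultimately have 1: "card {\<tau> \<in> stellar \<sigma> v \<Delta>. card \<tau> = Suc r} = card A + card S"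
    by (simp add: card_Un_disjoint card_image)
  have cU: "card (\<sigma> \<union> \<rho>) = card \<sigma> + card \<rho>" using finU disj by (simp add: card_Un_disjoint)
  have "S \<union> R = {\<tau>. \<tau> \<subseteq> \<sigma> \<union> \<rho> \<and> {} \<subseteq> \<tau> \<and> card \<tau> = r}" "S \<inter> R = {}"
    by (auto simp: S_def R_def)
  then have "card S + card R = (card \<sigma> + card \<rho>) choose (card \<sigma> + card \<rho> - r)"
    using card_Un_disjoint[OF \<open>finite S\<close> \<open>finite R\<close>] card_supersets_of_size[OF finU, of "{}" r] cU r
    by simp
  moreover have "card R = card \<sigma> choose (card \<sigma> + card \<rho> - r)"
    unfolding R_def using card_supersets_of_size[OF finU, of \<rho> r] cU r by simp
  ultimately show ?thesis using 1 by (simp add: A_def)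
qed

text \<open>The last clause is the invariant that permits further truncation: \<sigma> with
  \<open>d + 1 - i\<close> elements stands for a face of dimension \<open>i - 1\<close>, and its
  link being the boundary of \<rho> makes that face a simplex.\<close>

definition reachable :: "'a::euclidean_space itself \<Rightarrow> nat \<Rightarrow> nat \<Rightarrow> int \<Rightarrow> bool" where
  "reachable _ d r n \<longleftrightarrow> (\<exists>(L::'a set) a b I. simple_system L a b I \<and> dim L = d \<and>
     n = int (card {\<tau> \<in> simple_system.complex L a b I. card \<tau> = r}) \<and>
     (\<forall>i\<in>{1..r}. \<exists>\<sigma> \<rho>. simplex_link (simple_system.complex L a b I) \<sigma> \<rho> \<and>
        card \<sigma> = d + 1 - i \<and> card \<rho> = i))"

text \<open>When the \<open>d + 1\<close> indices are split into two nonempty blocks, each block has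
  the boundary of the other as its link.\<close>

lemma reachable_simplex:
  assumes "d \<le> DIM('a::euclidean_space)" "r \<le> d"
  shows "reachable TYPE('a) d r (int ((d + 1) choose r))"
proof -
  obtain L :: "'a set" and a b where sys: "simple_system L a b {..d}" "dim L = d"
    and cpx: "simple_system.complex L a b {..d} = {\<tau>. \<tau> \<subset> {..d}}"
    using simplex_system[OF assms(1)] by blast
  have "{\<tau>. \<tau> \<subset> {..d} \<and> card \<tau> = r} = {\<tau>. \<tau> \<subseteq> {..d} \<and> card \<tau> = r}"
    using assms(2) by auto
  then have "card {\<tau>. \<tau> \<subset> {..d} \<and> card \<tau> = r} = (d + 1) choose r"
    using n_subsets[of "{..d}" r] by simp
  moreover have "\<exists>\<sigma> \<rho>. simplex_link {\<tau>. \<tau> \<subset> {..d}} \<sigma> \<rho> \<and> card \<sigma> = d + 1 - i \<and> card \<rho> = i"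
    if "i \<in> {1..r}" for i
  proof -
    have V: "{..d} = {i..d} \<union> {..<i}" using that assms(2) by auto
    have "\<forall>\<tau>. \<tau> \<union> {i..d} \<subset> {..d} \<longleftrightarrow> \<tau> \<subseteq> {i..d} \<union> {..<i} \<and> \<not> {..<i} \<subseteq> \<tau>"
      unfolding V by auto
    moreover have "{i..d} \<inter> {..<i} = {}" by auto
    ultimately have "simplex_link {\<tau>. \<tau> \<subset> {..d}} {i..d} {..<i}"
      unfolding simplex_link_def mem_Collect_eq by (rule conjI[rotated])
    then show ?thesis by (intro exI[of _ "{i..d}"] exI[of _ "{..<i}"]) simp
  qed
  ultimately show ?thesis
    unfolding reachable_def using sys cpx
    by (intro exI[of _ L] exI[of _ a] exI[of _ b] exI[of _ "{..d}"]) simp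
qed

text \<open>
  Truncation of an \<open>(i - 1)\<close>-face that is a simplex. The new facet is a product of simplices, one of
  dimension at least \<open>r\<close>, which supplies simplex faces of all dimensions below \<open>r\<close> for
  the next truncation.
\<close>

lemma reachable_truncation:
  assumes "reachable TYPE('a::euclidean_space) d r n" "2 * r \<le> d" "1 \<le> i" "i \<le> r"
  shows "reachable TYPE('a) d r
    (n + int ((d + 1) choose (d + 2 - r)) - int ((d + 1 - i) choose (d + 2 - r)))"
proof -
  obtain L :: "'a set" and a b I where sys: "simple_system L a b I" "dim L = d"
    and n: "n = int (card {\<tau> \<in> simple_system.complex L a b I. card \<tau> = r})"
    and links: "\<And>i. i \<in> {1..r} \<Longrightarrow> \<exists>\<sigma> \<rho>. simplex_link (simple_system.complex L a b I) \<sigma> \<rho> \<and>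
        card \<sigma> = d + 1 - i \<and> card \<rho> = i"
    using assms(1) unfolding reachable_def by blast
  interpret simple_system L a b I by fact
  obtain \<sigma> \<rho> where link: "simplex_link complex \<sigma> \<rho>" and c: "card \<sigma> = d + 1 - i" "card \<rho> = i"
    using links[of i] assms(3,4) by auto
  have fin: "finite \<sigma>" "finite \<rho>" using c assms by (auto intro: card_ge_0_finite)
  have ne: "\<sigma> \<noteq> {}" "\<rho> \<noteq> {}" using c assms by auto
  \<comment> \<open>The empty \<tau> satisfies the link condition because \<rho> is
    nonempty.\<close>
  have \<sigma>: "\<sigma> \<in> complex" using link ne unfolding simplex_link_def by (metis Un_empty_left empty_subsetI subset_empty)
  obtain v where v: "v \<notin> I \<union> \<sigma> \<union> \<rho>"
    using ex_new_if_finite[of "I \<union> \<sigma> \<union> \<rho>"] finite_I fin by auto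
  obtain a' b' where sys': "simple_system L a' b' (insert v I)"
    and cpx': "simple_system.complex L a' b' (insert v I) = stellar \<sigma> v complex"
    using truncation[OF \<sigma> ne(1)] v by blast
  have v\<Delta>: "v \<notin> \<Union>complex" using v complex_subset by auto
  have fin\<Delta>: "finite \<tau>" if "\<tau> \<in> complex" for \<tau>
    using complex_subset[OF that] finite_I finite_subset by blast
  \<comment> \<open>Here \<open>2 * r \<le> d\<close> ensures \<open>r < card \<sigma>\<close>, so
    no member with \<open>r\<close> elements is lost.\<close>
  have "card {\<tau> \<in> stellar \<sigma> v complex. card \<tau> = Suc (r - 1)} + (card \<sigma> choose (card \<sigma> + card \<rho> - (r - 1)))
    = card {\<tau> \<in> complex. card \<tau> = Suc (r - 1)} + ((card \<sigma> + card \<rho>) choose (card \<sigma> + card \<rho> - (r - 1)))"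
    using c assms fin
    by (intro card_stellar[OF link complex_down finite_complex fin\<Delta> v\<Delta>]) auto
  moreover have "card \<sigma> + card \<rho> = d + 1" "Suc (r - 1) = r" "d + 1 - (r - 1) = d + 2 - r"
    using c assms by auto
  ultimately have "card {\<tau> \<in> stellar \<sigma> v complex. card \<tau> = r} + ((d + 1 - i) choose (d + 2 - r))
    = card {\<tau> \<in> complex. card \<tau> = r} + ((d + 1) choose (d + 2 - r))"
    using c by simp
  then have count: "n + int ((d + 1) choose (d + 2 - r)) - int ((d + 1 - i) choose (d + 2 - r))
      = int (card {\<tau> \<in> stellar \<sigma> v complex. card \<tau> = r})"
    unfolding n by linarith
  have "\<exists>\<sigma>' \<rho>'. simplex_link (stellar \<sigma> v complex) \<sigma>' \<rho>' \<and> card \<sigma>' = d + 1 - j \<and> card \<rho>' = j"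
    if j: "j \<in> {1..r}" for j
  proof -
    have "j \<le> card \<sigma>" using c j assms by auto
    then obtain \<rho>' where \<rho>': "\<rho>' \<subseteq> \<sigma>" "card \<rho>' = j" using obtain_subset_with_card_n by metis
    obtain p where p: "p \<in> \<rho>" using ne by blast
    let ?\<sigma>' = "insert v ((\<sigma> - \<rho>') \<union> (\<rho> - {p}))"
    have disj: "\<sigma> \<inter> \<rho> = {}" using link by (simp add: simplex_link_def)
    have "card ((\<sigma> - \<rho>') \<union> (\<rho> - {p})) = card (\<sigma> - \<rho>') + card (\<rho> - {p})"
      using fin disj by (intro card_Un_disjoint) auto
    also have "card (\<sigma> - \<rho>') = d + 1 - i - j"
      using \<rho>' fin c finite_subset[OF \<rho>'(1)] by (simp add: card_Diff_subset)
    also have "card (\<rho> - {p}) = i - 1" using p c fin by simp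
    finally have "card ?\<sigma>' = Suc (d + 1 - i - j + (i - 1))"
      using v fin by (subst card_insert_disjoint) auto
    \<comment> \<open>Since \<open>i + j \<le> 2 * r \<le> d\<close>, the subtractions of naturals
      are exact.\<close>
    then have "card ?\<sigma>' = d + 1 - j" using j assms by auto
    moreover have "simplex_link (stellar \<sigma> v complex) ?\<sigma>' \<rho>'"
      using v by (intro simplex_link_stellar[OF link complex_down v\<Delta> _ p \<rho>'(1)]) auto
    ultimately show ?thesis using \<rho>'(2) by blast
  qed
  then show ?thesis
    unfolding reachable_def using sys' sys(2) cpx' count
    by (intro exI[of _ L] exI[of _ a'] exI[of _ b'] exI[of _ "insert v I"]) simp
qed

lemma reachable_imp_face_number:
  assumes "reachable TYPE('a::euclidean_space) d (d - k) n" "k \<le> d" "1 \<le> d"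
  shows "is_simple_face_number TYPE('a) d k n"
proof -
  obtain L :: "'a set" and a b I where sys: "simple_system L a b I" "dim L = d"
    and n: "n = int (card {\<tau> \<in> simple_system.complex L a b I. card \<tau> = d - k})"
    using assms(1) unfolding reachable_def by blast
  interpret simple_system L a b I by fact
  show ?thesis
    unfolding is_simple_face_number_def
    using simple_d_polytope_cell num_faces_cell[of k] n sys(2) assms(2,3) by auto
qed

section \<open>Change-making and the attainment of all large numbers\<close>

text \<open>
  Greedy change-making with the coins \<open>(k + 1 + s) choose (k + 2)\<close>, whose consecutive ratios are
  at most \<open>k + 3\<close>.
\<close>

lemma greedy_deficit:
  fixes A :: "int \<Rightarrow> bool" and M :: int
  assumes step: "\<And>n s. A n \<Longrightarrow> s < r \<Longrightarrow> A (n + M - int ((k + 1 + s) choose (k + 2)))"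
    and "1 \<le> s" "s \<le> r" "A n" "0 \<le> x" "x < int ((k + 1 + s) choose (k + 2))"
  shows "\<exists>q\<le>(s - 1) * (k + 2). A (n + int q * M - x)"
  using assms(2-)
proof (induction s arbitrary: n x rule: nat_induct_at_least)
  case base
  \<comment> \<open>The coin for \<open>s = 1\<close> is 1.\<close>
  then have "x = 0" by simp
  then show ?case using base by (intro exI[of _ 0]) simp
next
  case (Suc s)
  define D where "D = (k + 1 + s) choose (k + 2)"
  have Dpos: "D > 0" using Suc.hyps by (simp add: D_def)
  \<comment> \<open>The ratio of consecutive coins is \<open>(k + 2 + s) / s\<close>, which is
    largest at \<open>s = 1\<close>.\<close>
  have "s * ((k + 1 + Suc s) choose (k + 2)) = (k + 2 + s) * D"
    using binomial_absorb_comp[of "k + 2 + s" "k + 2"] by (simp add: D_def)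
  also have "\<dots> \<le> s * (k + 3) * D"
  proof (rule mult_right_mono)
    show "k + 2 + s \<le> s * (k + 3)" using Suc.hyps by (cases s) auto
  qed simp
  finally have "(k + 1 + Suc s) choose (k + 2) \<le> (k + 3) * D"
    using Suc.hyps by (simp add: mult.assoc)
  then have "x < int ((k + 3) * D)" using Suc.prems(4) by linarith
  then have x_less: "x < int (k + 3) * int D" by (simp only: of_nat_mult)
  \<comment> \<open>The number of coins \<open>D\<close> that the greedy choice spends; the ratio
    bound keeps it at most \<open>k + 2\<close>.\<close>
  define p where "p = nat (x div int D)"
  have p: "int p = x div int D" using Suc.prems(3) Dpos by (simp add: p_def pos_imp_zdiv_nonneg_iff)
  have "x div int D * int D < int (k + 3) * int D"
    using x_less div_mult_mod_eq[of x "int D"] pos_mod_sign[of "int D" x] Dpos by linarith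
  then have "x div int D < int (k + 3)" by (rule mult_right_less_imp_less) simp
  then have p_le: "p \<le> k + 2" using p by linarith
  have iter: "A (n + int j * (M - int D))" for j
  proof (induction j)
    case (Suc j)
    then show ?case
      using step[OF Suc, of s] \<open>Suc s \<le> r\<close> by (simp add: D_def algebra_simps)
  qed (use Suc.prems in simp)
  have "0 \<le> x mod int D" "x mod int D < int D" "s \<le> r" using Dpos Suc.prems(1) by auto
  then obtain q where q: "q \<le> (s - 1) * (k + 2)"
    "A (n + int p * (M - int D) + int q * M - x mod int D)"
    using Suc.IH[OF _ iter[of p], folded D_def] by blast
  have "n + int p * (M - int D) + int q * M - x mod int D = n + int (p + q) * M - x"
    using p div_mult_mod_eq[of x "int D"] by (simp add: algebra_simps)
  moreover have "p + q \<le> (Suc s - 1) * (k + 2)"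
    using q(1) p_le Suc.hyps by (cases s) auto
  ultimately show ?case using q(2) by metis
qed

text \<open>With \<open>C\<close> the count for the simplex, \<open>n - C\<close> is
  \<open>N * M - x\<close> with \<open>0 \<le> x < M\<close>. The greedy choice absorbs
  \<open>x\<close> in at most \<open>(r - 1) * (k + 2)\<close> truncations, the bound on
  \<open>n\<close> makes \<open>N\<close> at least that number, and each remaining truncation adds
  exactly \<open>M\<close>.\<close>

lemma face_numbers_large:
  fixes n :: int
  assumes r: "1 \<le> r" "r \<le> k" "d = k + r" "d \<le> DIM('a::euclidean_space)"
    and n: "int (((d + 1) choose r) * (1 + (r - 1) * r)) \<le> n"
  shows "is_simple_face_number TYPE('a) d k n"
proof -
  define C where "C = (d + 1) choose r"
  define M where "M = (d + 1) choose (k + 2)"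
  have "C = (d + 1) choose (k + 1)"
    unfolding C_def using r binomial_symmetric[of r "d + 1"] by simp
  moreover have "Suc (k + 1) * ((d + 1) choose Suc (k + 1)) = (d + 1 - (k + 1)) * ((d + 1) choose (k + 1))"
    by (simp only: binomial_absorption binomial_absorb_comp)
  moreover have "d + 1 - (k + 1) = r" "Suc (k + 1) = k + 2" using r by auto
  ultimately have CM: "(k + 2) * M = r * C"
    by (simp only: M_def)
  have Mpos: "M > 0" using r by (simp add: M_def)
  let ?A = "reachable TYPE('a) d r"
  have dr: "d + 2 - r = k + 2" using r by simp
  \<comment> \<open>Truncating with \<open>i = r - s\<close> subtracts the coin numbered
    \<open>s\<close>.\<close>
  have step: "?A (m + int M - int ((k + 1 + s) choose (k + 2)))" if "?A m" "s < r" for m s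
  proof -
    have "d + 1 - (r - s) = k + 1 + s" using r that by simp
    then show ?thesis
      using reachable_truncation[OF that(1), of "r - s"] r that(2) by (simp add: M_def dr)
  qed
  define y where "y = n - int C"
  define x where "x = (- y) mod int M"
  define N where "N = - ((- y) div int M)"
  have y: "y = N * int M - x"
    unfolding N_def x_def using div_mult_mod_eq[of "- y" "int M"] by linarith
  have x: "0 \<le> x" "x < int M" using Mpos by (simp_all add: x_def)
  \<comment> \<open>The coin numbered \<open>r\<close> is \<open>M\<close> itself because
    \<open>d = k + r\<close>, so \<open>x < M\<close> is the bound that the greedy lemma asks
    for.\<close>
  obtain q where q: "q \<le> (r - 1) * (k + 2)" "?A (int C + int q * int M - x)"
    using greedy_deficit[of ?A r "int M" k r "int C" x, OF step _ _ _ x(1)] r x(2)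
      reachable_simplex[of d r, where 'a = 'a]
    by (auto simp: C_def M_def)
  \<comment> \<open>By \<open>CM\<close>, the bound on \<open>n\<close> is \<open>C\<close> plus
    \<open>(r - 1) * (k + 2)\<close> times \<open>M\<close>.\<close>
  have "int ((r - 1) * (k + 2)) * int M = int ((r - 1) * ((k + 2) * M))"
    by (simp only: of_nat_mult mult.assoc)
  also have "\<dots> = int ((r - 1) * r * C)" by (simp only: CM mult.assoc)
  also have "\<dots> = int (C * (1 + (r - 1) * r)) - int C" by (simp add: distrib_left)
  also have "\<dots> \<le> y" using n by (simp only: y_def C_def diff_right_mono)
  also have "\<dots> \<le> N * int M" using y x by simp
  finally have "int ((r - 1) * (k + 2)) \<le> N" using Mpos by simp
  then have qN: "int q \<le> N" using q(1) by linarith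
  \<comment> \<open>The coin numbered 0 is zero, so truncations with \<open>i = r\<close> add
    exactly \<open>M\<close>.\<close>
  have "?A (int C + int q * int M - x + int j * int M)" for j
  proof (induction j)
    case (Suc j)
    then show ?case using step[OF Suc, of 0] r by (simp add: algebra_simps binomial_eq_0)
  qed (use q in simp)
  from this[of "nat (N - int q)"] have "?A (int C + (N * int M - x))"
    using qN by (simp add: algebra_simps)
  moreover have "int C + (N * int M - x) = n" using y by (simp add: y_def)
  ultimately have "?A n" by (simp only:)
  then show ?thesis using r by (intro reachable_imp_face_number) auto
qed

section \<open>The gcd and the threshold\<close>

lemma G_gcd_eq_1:
  assumes "1 \<le> r" "r \<le> k" "d = k + r"
  shows "G_gcd d k = 1"
proof -
  \<comment> \<open>At \<open>i = r\<close> the first binomial is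
    \<open>(k + 1) choose (k + 1)\<close>, and the second vanishes since
    \<open>r \<le> k\<close>.\<close>
  have "m_coeff d r k = 1" using assms by (simp add: m_coeff_def binomial_eq_0)
  moreover have "r \<in> {1..d div 2}" using assms by auto
  ultimately have "1 \<in> (\<lambda>i. m_coeff d i k) ` {1..d div 2}" by force
  then show ?thesis unfolding G_gcd_def by (metis Gcd_1)
qed

text \<open>The integers are not well-ordered; the lower bound \<open>c\<close> shifts the predicate
  to the naturals, where a least witness exists.\<close>

lemma Least_int_le:
  fixes Q :: "int \<Rightarrow> bool"
  assumes "Q b" and lower: "\<And>x. Q x \<Longrightarrow> c \<le> x"
  shows "(LEAST x. Q x) \<le> b"
proof -
  define m where "m = (LEAST j. Q (c + int j))"
  have "Q (c + int (nat (b - c)))" using assms by simp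
  then have Qm: "Q (c + int m)" unfolding m_def by (rule LeastI)
  have "c + int m \<le> x" if "Q x" for x
  proof -
    have "Q (c + int (nat (x - c)))" using that lower[OF that] by simp
    then have "m \<le> nat (x - c)" unfolding m_def by (rule Least_le)
    then show ?thesis using lower[OF that] by linarith
  qed
  then have "(LEAST x. Q x) = c + int m" and "c + int m \<le> b"
    using Qm assms(1) by (auto intro: Least_equality)
  then show ?thesis by simp
qed

theorem theorem4p5:
  fixes d k :: nat
  assumes "d \<ge> 2"
    and "(d + 1) div 2 \<le> k" and "k \<le> d - 1"
    and "d \<le> DIM('a::euclidean_space)"
  shows "real_of_int (N_threshold TYPE('a) d k)
           < real ((d + 1) choose (d - k)) * real (d - k) * real (k + 1) * real (d + 1) / 2
       \<and> G_gcd d k = 1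
       \<and> (\<forall>n::int. real_of_int n
             \<ge> real ((d + 1) choose (d - k)) * real (d - k) * real (k + 1) * real (d + 1) / 2
           \<longrightarrow> is_simple_face_number TYPE('a) d k n)"
proof -
  define r where "r = d - k"
  have r: "1 \<le> r" "r \<le> k" "d = k + r" using assms by (auto simp: r_def)
  define C where "C = (d + 1) choose r"
  define B where "B = real C * real r * real (k + 1) * real (d + 1) / 2"
  \<comment> \<open>The factor 2 clears the denominator of \<open>B\<close>.\<close>
  have "2 * (1 + (r - 1) * r) \<le> 2 * (r * r)"
    using r(1) by (cases r) auto
  also have "\<dots> \<le> r * ((k + 1) * (d + 1))"
  proof -
    have "2 * r \<le> (k + 1) * (d + 1)" using r by (intro mult_mono) auto
    then have "r * (2 * r) \<le> r * ((k + 1) * (d + 1))" by (rule mult_left_mono) simp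
    then show ?thesis by (simp add: mult_ac)
  qed
  finally have "C * (2 * (1 + (r - 1) * r)) \<le> C * (r * ((k + 1) * (d + 1)))"
    by (rule mult_left_mono) simp
  then have "real (C * (2 * (1 + (r - 1) * r))) \<le> real (C * (r * ((k + 1) * (d + 1))))"
    by (rule of_nat_mono)
  then have le_B: "real (C * (1 + (r - 1) * r)) \<le> B"
    by (simp add: B_def algebra_simps)
  have G: "G_gcd d k = 1" using G_gcd_eq_1[OF r] .
  have large: "is_simple_face_number TYPE('a) d k n" if "B \<le> real_of_int n" for n
  proof -
    have "real_of_int (int (C * (1 + (r - 1) * r))) \<le> real_of_int n" using that le_B by simp
    then have "int (C * (1 + (r - 1) * r)) \<le> n" by (simp only: of_int_le_iff)
    then show ?thesis using face_numbers_large[OF r assms(4), of n] by (simp only: C_def)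
  qed
  let ?Q = "\<lambda>N. \<forall>n>N. is_simple_face_number TYPE('a) d k n \<longleftrightarrow> [n = 0] (mod G_gcd d k)"
  have Q: "?Q N \<longleftrightarrow> (\<forall>n>N. is_simple_face_number TYPE('a) d k n)" for N
    using G by simp
  \<comment> \<open>An integer above \<open>\<lceil>B\<rceil> - 1\<close> is at least
    \<open>B\<close>, while \<open>\<lceil>B\<rceil> - 1\<close> itself is strictly below
    \<open>B\<close>; this gives the strict bound.\<close>
  have "N_threshold TYPE('a) d k \<le> \<lceil>B\<rceil> - 1"
    unfolding N_threshold_def
  \<comment> \<open>Face numbers are nonnegative and \<open>N + 1\<close> must be one, so every
    valid threshold is at least -1.\<close>
  proof (rule Least_int_le[where c = "- 1"])
    show "?Q (\<lceil>B\<rceil> - 1)" unfolding Q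
    proof (intro allI impI large)
      fix n assume "\<lceil>B\<rceil> - 1 < n"
      then show "B \<le> real_of_int n" by linarith
    qed
  next
    fix N assume "?Q N"
    then have "is_simple_face_number TYPE('a) d k (N + 1)" unfolding Q by simp
    then have "N + 1 \<ge> 0" by (auto simp: is_simple_face_number_def)
    then show "- 1 \<le> N" by simp
  qed
  then have "real_of_int (N_threshold TYPE('a) d k) < B" by linarith
  then show ?thesis using G large unfolding B_def C_def r_def by blast
qed

end
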